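(* Let $\rho\subseteq N^2$ be a binary relation. (a) $\widetilde{\rho^{-1}}=(\widetilde{\rho})^{-1}$. (b) If $\rho$ is reflexive (on $N$), then $\widetilde{\rho}$ is reflexive (on $\beta N$). If $\rho$ is symmetric, then so is $\widetilde{\rho}$. If $\rho$ is transitive, then so is $\widetilde{\rho}$.
   Context: $N=\{1,2,3,\dots\}$ and $\beta N$ is the set of all ultrafilters on $N$. For $\rho\subseteq N^2$ and $A\subseteq N$, $\rho[A]=\{n\in N:\exists m\in A\ (m,n)\in\rho\}$. For a relation $\sigma$, $\sigma^{-1}=\{(y,x):(x,y)\in\sigma\}$ denotes the inverse relation. For $\rho\subseteq N^2$, $\widetilde{\rho}=\{(p,q)\in(\beta N)^2:\forall A\in p\ \ \rho[A]\in q\}$. *)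

theory Defs
  imports Main
begin

abbreviation posnats :: "nat set" where
  "posnats \<equiv> {1..}"

definition ultrafilter_on :: "'a set \<Rightarrow> 'a set set \<Rightarrow> bool" where
  "ultrafilter_on X p \<longleftrightarrow>
     p \<subseteq> Pow X \<and>
     X \<in> p \<and>
     {} \<notin> p \<and>
     (\<forall>A B. A \<in> p \<and> B \<in> p \<longrightarrow> A \<inter> B \<in> p) \<and>
     (\<forall>A B. A \<in> p \<and> A \<subseteq> B \<and> B \<subseteq> X \<longrightarrow> B \<in> p) \<and>
     (\<forall>A. A \<subseteq> X \<longrightarrow> A \<in> p \<or> X - A \<in> p)"

definition betaN :: "nat set set set" where
  "betaN = {p. ultrafilter_on posnats p}"

text \<open>
  For \<open>\<rho> \<subseteq> posnats \<times> posnats\<close> the relational image \<open>\<rho> `` A\<close> is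
  \<open>{n \<in> posnats. \<exists>m\<in>A. (m, n) \<in> \<rho>}\<close>.
\<close>

definition tilde :: "nat rel \<Rightarrow> nat set set rel" where
  "tilde \<rho> = {(p, q). p \<in> betaN \<and> q \<in> betaN \<and> (\<forall>A\<in>p. \<rho> `` A \<in> q)}"

end

theory Submission
  imports Defs
begin

text \<open>
  The condition ``\<open>\<rho> `` A \<in> q\<close> for all \<open>A \<in> p\<close>'' looks asymmetric in \<open>p\<close> and \<open>q\<close>, but
  for ultrafilters it is not. A set \<open>B\<close> misses \<open>\<rho> `` A\<close> exactly when \<open>A\<close> misses
  \<open>\<rho>\<inverse> `` B\<close>; so if some \<open>B \<in> q\<close> had \<open>\<rho>\<inverse> `` B \<notin> p\<close>, the complement \<open>A\<close> of \<open>\<rho>\<inverse> `` B\<close>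
  would lie in \<open>p\<close>, and then \<open>q\<close> would contain the disjoint sets \<open>B\<close> and \<open>\<rho> `` A\<close>.
  This is lemma \<open>converse_Image_mem_ultrafilter\<close>; it gives the statement on inverses, and
  symmetry is the case \<open>\<rho>\<inverse> = \<rho>\<close>. Reflexivity and transitivity hold because ultrafilters
  are closed under supersets: if \<open>\<rho>\<close> is reflexive then \<open>A \<subseteq> \<rho> `` A\<close>, and if \<open>\<rho>\<close> is
  transitive then \<open>\<rho> `` (\<rho> `` A) \<subseteq> \<rho> `` A\<close>.
\<close>

lemma ultrafilter_on_superset:
  assumes "ultrafilter_on X p" "A \<in> p" "A \<subseteq> B" "B \<subseteq> X"
  shows "B \<in> p"
  using assms unfolding ultrafilter_on_def by blast

text \<open>
  Maximality of \<open>p\<close> supplies the complement of \<open>\<rho>\<inverse> `` B\<close>, and properness of \<open>q\<close> rules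
  out that its image avoids \<open>B\<close>.
\<close>

lemma converse_Image_mem_ultrafilter:
  assumes p: "ultrafilter_on X p" and q: "ultrafilter_on Y q"
    and \<rho>: "\<rho> \<subseteq> X \<times> Y"
    and image: "\<And>A. A \<in> p \<Longrightarrow> \<rho> `` A \<in> q"
    and B: "B \<in> q"
  shows "\<rho>\<inverse> `` B \<in> p"
proof (rule ccontr)
  assume "\<rho>\<inverse> `` B \<notin> p"
  moreover have "\<rho>\<inverse> `` B \<subseteq> X"
    using \<rho> by blast
  ultimately have "X - \<rho>\<inverse> `` B \<in> p"
    using p unfolding ultrafilter_on_def by blast
  then have "\<rho> `` (X - \<rho>\<inverse> `` B) \<in> q"
    by (rule image)
  with B q have "\<rho> `` (X - \<rho>\<inverse> `` B) \<inter> B \<in> q"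
    by (simp add: ultrafilter_on_def)
  moreover have "\<rho> `` (X - \<rho>\<inverse> `` B) \<inter> B = {}"
    by blast
  ultimately show False
    using q by (simp add: ultrafilter_on_def)
qed

lemma converse_tilde_subset:
  assumes "\<rho> \<subseteq> posnats \<times> posnats"
  shows "(tilde \<rho>)\<inverse> \<subseteq> tilde (\<rho>\<inverse>)"
proof (rule subrelI)
  fix q p
  assume "(q, p) \<in> (tilde \<rho>)\<inverse>"
  then have p: "ultrafilter_on posnats p" and q: "ultrafilter_on posnats q"
    and image: "\<And>A. A \<in> p \<Longrightarrow> \<rho> `` A \<in> q"
    by (auto simp: tilde_def betaN_def)
  from converse_Image_mem_ultrafilter[OF p q assms image] show "(q, p) \<in> tilde (\<rho>\<inverse>)"
    using p q by (simp add: tilde_def betaN_def)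
qed

text \<open>
  One inclusion for every \<open>\<rho>\<close> suffices, since the other is the same inclusion for \<open>\<rho>\<inverse>\<close>.
\<close>

lemma tilde_converse:
  assumes "\<rho> \<subseteq> posnats \<times> posnats"
  shows "tilde (\<rho>\<inverse>) = (tilde \<rho>)\<inverse>"
proof
  have "\<rho>\<inverse> \<subseteq> posnats \<times> posnats"
    using assms by blast
  from converse_tilde_subset[OF this] show "tilde (\<rho>\<inverse>) \<subseteq> (tilde \<rho>)\<inverse>"
    by auto
  show "(tilde \<rho>)\<inverse> \<subseteq> tilde (\<rho>\<inverse>)"
    by (rule converse_tilde_subset[OF assms])
qed

lemma refl_on_tilde:
  assumes \<rho>: "\<rho> \<subseteq> posnats \<times> posnats" and refl: "refl_on posnats \<rho>"
  shows "refl_on betaN (tilde \<rho>)"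
proof -
  have "(p, p) \<in> tilde \<rho>" if "p \<in> betaN" for p
  proof -
    have p: "ultrafilter_on posnats p"
      using that by (simp add: betaN_def)
    have "\<rho> `` A \<in> p" if A: "A \<in> p" for A
    proof (rule ultrafilter_on_superset[OF p A])
      have "A \<subseteq> posnats"
        using p A by (auto simp only: ultrafilter_on_def)
      then show "A \<subseteq> \<rho> `` A"
        using refl unfolding refl_on_def by blast
      show "\<rho> `` A \<subseteq> posnats"
        using \<rho> by blast
    qed
    then show ?thesis
      using that by (simp add: tilde_def)
  qed
  then show ?thesis
    unfolding refl_on_def tilde_def by blast
qed

lemma sym_tilde:
  assumes "\<rho> \<subseteq> posnats \<times> posnats" and "sym \<rho>"
  shows "sym (tilde \<rho>)"
  using assms tilde_converse[of \<rho>] by (metis sym_conv_converse_eq)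

lemma trans_tilde:
  assumes \<rho>: "\<rho> \<subseteq> posnats \<times> posnats" and trans: "trans \<rho>"
  shows "trans (tilde \<rho>)"
proof (rule transI)
  fix p q r
  assume pq: "(p, q) \<in> tilde \<rho>" and qr: "(q, r) \<in> tilde \<rho>"
  have r: "ultrafilter_on posnats r"
    using qr by (simp add: tilde_def betaN_def)
  have "\<rho> `` A \<in> r" if "A \<in> p" for A
  proof (rule ultrafilter_on_superset[OF r])
    show "\<rho> `` (\<rho> `` A) \<in> r"
      using that pq qr by (simp add: tilde_def)
    show "\<rho> `` (\<rho> `` A) \<subseteq> \<rho> `` A"
      using trans by (blast dest: transD)
    show "\<rho> `` A \<subseteq> posnats"
      using \<rho> by blast
  qed
  then show "(p, r) \<in> tilde \<rho>"
    using pq qr by (simp add: tilde_def)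
qed

theorem theorem2p11:
  fixes \<rho> :: "nat rel"
  assumes "\<rho> \<subseteq> posnats \<times> posnats"
  shows "tilde (\<rho>\<inverse>) = (tilde \<rho>)\<inverse>
    \<and> (refl_on posnats \<rho> \<longrightarrow> refl_on betaN (tilde \<rho>))
    \<and> (sym \<rho> \<longrightarrow> sym (tilde \<rho>))
    \<and> (trans \<rho> \<longrightarrow> trans (tilde \<rho>))"
  using tilde_converse[OF assms] refl_on_tilde[OF assms] sym_tilde[OF assms]
    trans_tilde[OF assms]
  by blast

end
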